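(* Let $B$ be a finite group of nilpotency class 2 of odd order, let $\Omega$ be an orbit of the coadjoint representation of $B$ in $L(B)^*$, and let $\tau(\Omega)$ be the corresponding (class of) irreducible unitary representation of $B$, with $n=\dim\tau(\Omega)$. Then for every $b\in B$ and every $\chi\in\Omega$, the character of $\tau(\Omega)$ satisfies $$\operatorname{char}\tau(\Omega)(b)=\begin{cases} n\,\chi(b) & \text{if } b\in\operatorname{Stab}\chi,\\ 0 & \text{otherwise,}\end{cases}$$ where $\operatorname{Stab}\chi\subset B$ is the stabilizer of $\chi$ under the coadjoint representation.
   Context: A group $B$ is said to be of nilpotency class 2 if $B/A$ is abelian, where $A$ is the center of $B$ (abelian groups are included). An abelian group $A$ (written additively) is 2-divisible if $a\mapsto a+a$ is an automorphism of $A$; then $a/2$ denotes the image of $a$ under the inverse. A finite group of odd order has 2-divisible center. The Lie ring $L(B)$: let $B$ be a group of nilpotency class 2 with 2-divisible center $A$, and $C=B/A$ (both written additively). Choose a set-theoretic section $s:C\to B$; every $b\in B$ is uniquely $b=a\cdot s(c)$ with $a\in A$, $c\in C$, written $b=(a,c)$. Put $\psi(c_1,c_2)=s(c_1)s(c_2)s(c_1+c_2)^{-1}\in A$, $\phi(c_1,c_2)=\frac{\psi(c_1,c_2)+\psi(c_2,c_1)}{2}$, $\eta(c_1,c_2)=\psi(c_1,c_2)-\psi(c_2,c_1)$. $L(B)$ is the Lie ring with the same underlying set as $B$, addition $(a_1,c_1)+(a_2,c_2)=(a_1+a_2+\phi(c_1,c_2),\,c_1+c_2)$ and bracket $[(a_1,c_1),(a_2,c_2)]=\eta(c_1,c_2)\in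 A\subset B$. This does not depend on the choice of $s$. In $\chi(b)$, $b\in B$ is regarded as an element of $L(B)$. $L(B)^*$ is the group of unitary characters of the additive group of $L(B)$. The adjoint representation is $\operatorname{Ad}(b)(l)=b\cdot l\cdot b^{-1}$ (an element of $B$ regarded as an element of $L(B)$), and the coadjoint representation is the left action of $B$ on $L(B)^*$ given by $\operatorname{Ad}^*(b)(\chi)(l)=\chi(\operatorname{Ad}(b^{-1})(l))$. The correspondence $\Omega\mapsto\tau(\Omega)$: for $\chi\in L(B)^*$ put $X_\chi=\sum_{l\in L(B)}\chi(l)\,l\in\mathbb C[B]$, and for a coadjoint orbit $\Omega$ put $V_\Omega=\operatorname{span}(X_\chi)_{\chi\in\Omega}$. Each $V_\Omega$ is an isotypic component of the regular representation $R(g)x=xg^{-1}$ of $B$ in $\mathbb C[B]$, and $\tau(\Omega)$ is the class of irreducible unitary representations of $B$ such that $R|_{V_\Omega}\simeq n\,\tau(\Omega)$ with $n=\dim\tau(\Omega)$. *)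

theory Defs
  imports
    "HOL-Analysis.Analysis"
    "HOL-Algebra.Group_Action"
    "HOL-Library.Function_Algebras"
begin

section \<open>Groups of nilpotency class 2\<close>

definition group_center :: "('a, 'm) monoid_scheme \<Rightarrow> 'a set" where
  "group_center B = {a \<in> carrier B. \<forall>b \<in> carrier B. a \<otimes>\<^bsub>B\<^esub> b = b \<otimes>\<^bsub>B\<^esub> a}"

definition nilpotency_class_2 :: "('a, 'm) monoid_scheme \<Rightarrow> bool" where
  "nilpotency_class_2 B \<longleftrightarrow> group B \<and> comm_group (B Mod group_center B)"


section \<open>The Lie ring of a group of nilpotency class 2\<close>

text \<open>
  The centre \<open>A\<close> and the quotient \<open>C = B/A\<close> keep the multiplicative notation of \<open>B\<close>.
  Elements of \<open>C\<close> are cosets, and \<open>A #> b\<close> is the image of \<open>b\<close> in \<open>C\<close>.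
\<close>

definition is_section :: "('a, 'm) monoid_scheme \<Rightarrow> ('a set \<Rightarrow> 'a) \<Rightarrow> bool" where
  "is_section B s \<longleftrightarrow>
     (\<forall>c \<in> carrier (B Mod group_center B). s c \<in> carrier B \<and> group_center B #>\<^bsub>B\<^esub> s c = c)"

definition C_part :: "('a, 'm) monoid_scheme \<Rightarrow> 'a \<Rightarrow> 'a set" where
  "C_part B b = group_center B #>\<^bsub>B\<^esub> b"

definition A_part :: "('a, 'm) monoid_scheme \<Rightarrow> ('a set \<Rightarrow> 'a) \<Rightarrow> 'a \<Rightarrow> 'a" where
  "A_part B s b = b \<otimes>\<^bsub>B\<^esub> inv\<^bsub>B\<^esub> (s (C_part B b))"

text \<open>
  The element \<open>a/2\<close> of \<open>A\<close>. It is meaningful only if \<open>A\<close> is 2-divisible, which is the case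
  for finite groups of odd order.
\<close>
definition center_half :: "('a, 'm) monoid_scheme \<Rightarrow> 'a \<Rightarrow> 'a" where
  "center_half B = the_inv_into (group_center B) (\<lambda>a. a \<otimes>\<^bsub>B\<^esub> a)"

definition psi :: "('a, 'm) monoid_scheme \<Rightarrow> ('a set \<Rightarrow> 'a) \<Rightarrow> 'a set \<Rightarrow> 'a set \<Rightarrow> 'a" where
  "psi B s c1 c2 = s c1 \<otimes>\<^bsub>B\<^esub> s c2 \<otimes>\<^bsub>B\<^esub> inv\<^bsub>B\<^esub> (s (c1 \<otimes>\<^bsub>B Mod group_center B\<^esub> c2))"

definition phi :: "('a, 'm) monoid_scheme \<Rightarrow> ('a set \<Rightarrow> 'a) \<Rightarrow> 'a set \<Rightarrow> 'a set \<Rightarrow> 'a" where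
  "phi B s c1 c2 = center_half B (psi B s c1 c2 \<otimes>\<^bsub>B\<^esub> psi B s c2 c1)"

definition eta :: "('a, 'm) monoid_scheme \<Rightarrow> ('a set \<Rightarrow> 'a) \<Rightarrow> 'a set \<Rightarrow> 'a set \<Rightarrow> 'a" where
  "eta B s c1 c2 = psi B s c1 c2 \<otimes>\<^bsub>B\<^esub> inv\<^bsub>B\<^esub> (psi B s c2 c1)"

text \<open>
  A Lie ring is recorded as its additive group (the \<open>monoid\<close> part, so that \<open>mult\<close> is the
  addition and \<open>one\<close> is zero) together with the bracket.
\<close>
record 'a lie_ring = "'a monoid" +
  bracket :: "'a \<Rightarrow> 'a \<Rightarrow> 'a"

text \<open>
  The pair \<open>(a, c)\<close> stands for \<open>a \<otimes> s c\<close>. Since \<open>\<phi>(0,0) = \<psi>(0,0) = s 0\<close>, the zero element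
  is the pair \<open>(- s 0, 0)\<close>, that is, the unit of \<open>B\<close>.
\<close>
definition lie_ring_of :: "('a, 'm) monoid_scheme \<Rightarrow> ('a set \<Rightarrow> 'a) \<Rightarrow> 'a lie_ring" where
  "lie_ring_of B s =
     \<lparr>carrier = carrier B,
      mult = (\<lambda>b1 b2.
        (A_part B s b1 \<otimes>\<^bsub>B\<^esub> A_part B s b2 \<otimes>\<^bsub>B\<^esub> phi B s (C_part B b1) (C_part B b2))
          \<otimes>\<^bsub>B\<^esub> s (C_part B b1 \<otimes>\<^bsub>B Mod group_center B\<^esub> C_part B b2)),
      one = \<one>\<^bsub>B\<^esub>,
      bracket = (\<lambda>b1 b2. eta B s (C_part B b1) (C_part B b2))\<rparr>"


section \<open>Unitary characters and the coadjoint representation\<close>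

definition circle_group :: "complex monoid" where
  "circle_group = \<lparr>carrier = {z. norm z = 1}, mult = (*), one = 1\<rparr>"

text \<open>
  Characters are extensional functions, so that equality of characters is equality on \<open>L(B)\<close>.
\<close>
definition unitary_characters :: "('a, 'm) monoid_scheme \<Rightarrow> ('a \<Rightarrow> complex) set" where
  "unitary_characters L = hom L circle_group \<inter> extensional (carrier L)"

abbreviation lie_dual :: "('a, 'm) monoid_scheme \<Rightarrow> ('a set \<Rightarrow> 'a) \<Rightarrow> ('a \<Rightarrow> complex) set" where
  "lie_dual B s \<equiv> unitary_characters (lie_ring_of B s)"

definition Ad :: "('a, 'm) monoid_scheme \<Rightarrow> 'a \<Rightarrow> 'a \<Rightarrow> 'a" where
  "Ad B b l = b \<otimes>\<^bsub>B\<^esub> l \<otimes>\<^bsub>B\<^esub> inv\<^bsub>B\<^esub> b"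

definition coAd ::
  "('a, 'm) monoid_scheme \<Rightarrow> ('a set \<Rightarrow> 'a) \<Rightarrow> 'a \<Rightarrow> ('a \<Rightarrow> complex) \<Rightarrow> ('a \<Rightarrow> complex)" where
  "coAd B s b = (\<lambda>chi \<in> lie_dual B s. \<lambda>l \<in> carrier (lie_ring_of B s). chi (Ad B (inv\<^bsub>B\<^esub> b) l))"


section \<open>The group algebra and its right regular representation\<close>

text \<open>
  For finite \<open>B\<close>, the algebra \<open>\<complex>[B]\<close> consists of the functions \<open>x :: 'a \<Rightarrow> complex\<close> vanishing
  outside \<open>carrier B\<close>, where \<open>x\<close> stands for the formal sum of the \<open>x g\<close> times \<open>g\<close>. Addition is
  pointwise. The product is the convolution \<open>ga_mult\<close>, not the pointwise product of functions.
\<close>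

definition ga_scale :: "complex \<Rightarrow> ('a \<Rightarrow> complex) \<Rightarrow> ('a \<Rightarrow> complex)" where
  "ga_scale c x = (\<lambda>g. c * x g)"

lemma vector_space_ga_scale: "vector_space ga_scale"
  by unfold_locales (auto simp: ga_scale_def fun_eq_iff algebra_simps)

definition ga_of :: "'a \<Rightarrow> ('a \<Rightarrow> complex)" where
  "ga_of g = (\<lambda>h. if h = g then 1 else 0)"

definition ga_mult ::
  "('a, 'm) monoid_scheme \<Rightarrow> ('a \<Rightarrow> complex) \<Rightarrow> ('a \<Rightarrow> complex) \<Rightarrow> ('a \<Rightarrow> complex)" where
  "ga_mult B x y =
     (\<lambda>g. if g \<in> carrier B then \<Sum>h \<in> carrier B. x h * y (inv\<^bsub>B\<^esub> h \<otimes>\<^bsub>B\<^esub> g) else 0)"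

definition regular_rep ::
  "('a, 'm) monoid_scheme \<Rightarrow> 'a \<Rightarrow> ('a \<Rightarrow> complex) \<Rightarrow> ('a \<Rightarrow> complex)" where
  "regular_rep B g x = ga_mult B x (ga_of (inv\<^bsub>B\<^esub> g))"

definition X_elem :: "('a, 'm) monoid_scheme \<Rightarrow> ('a \<Rightarrow> complex) \<Rightarrow> ('a \<Rightarrow> complex)" where
  "X_elem B chi = (\<Sum>l \<in> carrier B. ga_scale (chi l) (ga_of l))"

definition V_space ::
  "('a, 'm) monoid_scheme \<Rightarrow> ('a \<Rightarrow> complex) set \<Rightarrow> ('a \<Rightarrow> complex) set" where
  "V_space B \<Omega> = module.span ga_scale (X_elem B ` \<Omega>)"


section \<open>Representations and the correspondence between orbits and representations\<close>

definition unitary_matrix :: "complex^'n^'n \<Rightarrow> bool" where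
  "unitary_matrix U \<longleftrightarrow>
     U ** (\<chi> i j. cnj (U $ j $ i)) = mat 1 \<and> (\<chi> i j. cnj (U $ j $ i)) ** U = mat 1"

text \<open>Unitary representations on the standard Hermitian space of dimension \<open>CARD('n)\<close>.\<close>
definition unitary_rep :: "('a, 'm) monoid_scheme \<Rightarrow> ('a \<Rightarrow> complex^'n^'n) \<Rightarrow> bool" where
  "unitary_rep B \<rho> \<longleftrightarrow>
     (\<forall>g \<in> carrier B. unitary_matrix (\<rho> g)) \<and>
     \<rho> \<one>\<^bsub>B\<^esub> = mat 1 \<and>
     (\<forall>g \<in> carrier B. \<forall>h \<in> carrier B. \<rho> (g \<otimes>\<^bsub>B\<^esub> h) = \<rho> g ** \<rho> h)"

text \<open>The underlying space is nonzero because index types are nonempty.\<close>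
definition irreducible_rep :: "('a, 'm) monoid_scheme \<Rightarrow> ('a \<Rightarrow> complex^'n^'n) \<Rightarrow> bool" where
  "irreducible_rep B \<rho> \<longleftrightarrow>
     (\<forall>W. vec.subspace W \<and> (\<forall>g \<in> carrier B. \<forall>w \<in> W. \<rho> g *v w \<in> W) \<longrightarrow> W = {0} \<or> W = UNIV)"

text \<open>
  Linear equivalence of the representations \<open>\<pi>1\<close> and \<open>\<pi>2\<close> on subspaces \<open>V1\<close> and \<open>V2\<close> of two
  complex vector spaces with scalar multiplications \<open>sc1\<close> and \<open>sc2\<close>.
\<close>
definition equivalent_reps ::
  "('a, 'm) monoid_scheme \<Rightarrow>
   (complex \<Rightarrow> 'v::ab_group_add \<Rightarrow> 'v) \<Rightarrow> 'v set \<Rightarrow> ('a \<Rightarrow> 'v \<Rightarrow> 'v) \<Rightarrow>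
   (complex \<Rightarrow> 'w::ab_group_add \<Rightarrow> 'w) \<Rightarrow> 'w set \<Rightarrow> ('a \<Rightarrow> 'w \<Rightarrow> 'w) \<Rightarrow> bool" where
  "equivalent_reps B sc1 V1 \<pi>1 sc2 V2 \<pi>2 \<longleftrightarrow>
     (\<forall>g \<in> carrier B. \<forall>x \<in> V1. \<pi>1 g x \<in> V1) \<and>
     (\<forall>g \<in> carrier B. \<forall>y \<in> V2. \<pi>2 g y \<in> V2) \<and>
     (\<exists>T. bij_betw T V1 V2 \<and>
          (\<forall>x \<in> V1. \<forall>y \<in> V1. T (x + y) = T x + T y) \<and>
          (\<forall>c. \<forall>x \<in> V1. T (sc1 c x) = sc2 c (T x)) \<and>
          (\<forall>g \<in> carrier B. \<forall>x \<in> V1. T (\<pi>1 g x) = \<pi>2 g (T x)))"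

text \<open>The direct sum of \<open>m\<close> copies of \<open>\<rho>\<close>, on the sequences supported on the indices below \<open>m\<close>.\<close>

definition multiple_scale :: "complex \<Rightarrow> (nat \<Rightarrow> complex^'n) \<Rightarrow> (nat \<Rightarrow> complex^'n)" where
  "multiple_scale c v = (\<lambda>i. c *s v i)"

definition multiple_space :: "nat \<Rightarrow> (nat \<Rightarrow> complex^'n) set" where
  "multiple_space m = {v. \<forall>i \<ge> m. v i = 0}"

definition multiple_rep ::
  "('a \<Rightarrow> complex^'n^'n) \<Rightarrow> 'a \<Rightarrow> (nat \<Rightarrow> complex^'n) \<Rightarrow> (nat \<Rightarrow> complex^'n)" where
  "multiple_rep \<rho> g v = (\<lambda>i. \<rho> g *v v i)"

text \<open>
  The class \<open>\<tau>(\<Omega>)\<close>, as the set of its realisations by unitary matrices of size \<open>CARD('n)\<close>.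
  It is empty unless \<open>CARD('n)\<close> is the dimension of \<open>\<tau>(\<Omega>)\<close>.
\<close>
definition tau ::
  "('a, 'm) monoid_scheme \<Rightarrow> ('a \<Rightarrow> complex) set \<Rightarrow> ('a \<Rightarrow> complex^'n^'n) set" where
  "tau B \<Omega> = {\<rho>. unitary_rep B \<rho> \<and> irreducible_rep B \<rho> \<and>
     equivalent_reps B ga_scale (V_space B \<Omega>) (regular_rep B)
       multiple_scale (multiple_space CARD('n)) (multiple_rep \<rho>)}"

definition rep_character :: "('a \<Rightarrow> complex^'n^'n) \<Rightarrow> 'a \<Rightarrow> complex" where
  "rep_character \<rho> b = trace (\<rho> b)"

end

theory Submission
  imports Defs "HOL-Algebra.Multiplicative_Group"
begin

text \<open>
  Since \<open>B\<close> has odd order, every \<open>g\<close> has a square root \<open>g\<^sup>1\<^sup>/\<^sup>2\<close>, a power of \<open>g\<close>, and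
  \<open>x \<otimes> y = [x, y]\<^sup>1\<^sup>/\<^sup>2 \<otimes> (x + y)\<close>, where the sum is that of \<open>L(B)\<close>. Hence
  \<open>\<chi>(h \<otimes> g) = \<chi>(g) \<cdot> \<chi>([h, g\<^sup>1\<^sup>/\<^sup>2]) \<cdot> \<chi>(h)\<close>, which says that
  \<open>R(g) X\<^sub>\<chi> = \<chi>(g) X\<^sub>\<chi>\<^sub>'\<close> with \<open>\<chi>' = Ad\<^sup>*(g\<^sup>1\<^sup>/\<^sup>2) \<chi>\<close>. The \<open>X\<^sub>\<chi>\<close> are
  orthogonal, so they form a basis of \<open>V\<^sub>\<Omega>\<close>, permuted by \<open>R(g)\<close> up to scalars. Stabilizers contain
  all commutators and are therefore constant on \<open>\<Omega>\<close>, and \<open>g\<^sup>1\<^sup>/\<^sup>2\<close> lies in the stabilizer iff \<open>g\<close>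
  does. So the trace of \<open>R(g)\<close> on \<open>V\<^sub>\<Omega>\<close>, which is \<open>n\<close> times the character, is \<open>|\<Omega>| \<chi>(g)\<close> on the
  stabilizer and \<open>0\<close> elsewhere; \<open>g = 1\<close> gives \<open>|\<Omega>| = n\<^sup>2\<close>.
\<close>

section \<open>Traces of equivalent representations\<close>

text \<open>Linearity is demanded on \<open>V\<close> only: the intertwiner in
  \<open>equivalent_reps\<close> is constrained nowhere else.\<close>

definition linear_on where
  "linear_on sc1 V sc2 f \<longleftrightarrow>
     (\<forall>x\<in>V. \<forall>y\<in>V. f (x + y) = f x + f y) \<and> (\<forall>c. \<forall>x\<in>V. f (sc1 c x) = sc2 c (f x))"

lemma linear_on_sum:
  fixes f :: "'v::ab_group_add \<Rightarrow> 'w::ab_group_add"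
  assumes sub: "Modules.module sc1" "Modules.module.subspace sc1 V" and lin: "linear_on sc1 V sc2 f"
    and fin: "finite I" and X: "\<And>i. i \<in> I \<Longrightarrow> X i \<in> V"
  shows "f (\<Sum>i\<in>I. sc1 (c i) (X i)) = (\<Sum>i\<in>I. sc2 (c i) (f (X i)))"
proof -
  interpret Modules.module sc1 by fact
  note sub = sub(2)
  \<comment> \<open>The empty sum requires \<open>f 0 = 0\<close>; additivity at
    \<open>0 \<in> V\<close> gives it.\<close>
  have "f (0 + 0) = f 0 + f 0"
    using lin subspace_0[OF sub] unfolding linear_on_def by blast
  then have zero: "f 0 = 0" by simp
  show ?thesis using fin X
  proof (induction I)
    case (insert i I)
    have "(\<Sum>i\<in>I. sc1 (c i) (X i)) \<in> V"
      using insert.prems by (intro subspace_sum[OF sub] subspace_scale[OF sub]) auto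
    moreover have "X i \<in> V" "sc1 (c i) (X i) \<in> V"
      using insert.prems subspace_scale[OF sub] by auto
    ultimately show ?case
      using insert lin by (simp add: linear_on_def)
  qed (simp add: zero)
qed

text \<open>Both sides are the trace of \<open>P\<close>, computed in the coordinates \<open>l\<close> of the basis \<open>X\<close> of \<open>V\<close>
  and, after transport along \<open>T\<close>, in the coordinates \<open>m\<close> of the basis \<open>E\<close> of \<open>W\<close>.\<close>

lemma trace_transport:
  fixes sc1 :: "complex \<Rightarrow> 'v::ab_group_add \<Rightarrow> 'v" and sc2 :: "complex \<Rightarrow> 'w::ab_group_add \<Rightarrow> 'w"
  assumes V: "Modules.module sc1" "Modules.module.subspace sc1 V" and W: "Modules.module sc2" "Modules.module.subspace sc2 W"
    and fin: "finite I" "finite J"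
    and X: "\<And>i. i \<in> I \<Longrightarrow> X i \<in> V" and E: "\<And>j. j \<in> J \<Longrightarrow> E j \<in> W"
    and l: "\<And>i. i \<in> I \<Longrightarrow> linear_on sc1 V (*) (l i)"
    and m: "\<And>j. j \<in> J \<Longrightarrow> linear_on sc2 W (*) (m j)"
    and X_rep: "\<And>x. x \<in> V \<Longrightarrow> x = (\<Sum>i\<in>I. sc1 (l i x) (X i))"
    and E_rep: "\<And>y. y \<in> W \<Longrightarrow> y = (\<Sum>j\<in>J. sc2 (m j y) (E j))"
    and T: "bij_betw T V W" "linear_on sc1 V sc2 T"
    and P: "\<And>x. x \<in> V \<Longrightarrow> P x \<in> V" "linear_on sc1 V sc1 P"
    and Q: "\<And>x. x \<in> V \<Longrightarrow> T (P x) = Q (T x)"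
  shows "(\<Sum>i\<in>I. l i (P (X i))) = (\<Sum>j\<in>J. m j (Q (E j)))"
proof -
  interpret V: Modules.module sc1 by fact
  define S where "S = the_inv_into V T"
  have ST: "S (T x) = x" if "x \<in> V" for x
    using T(1) that unfolding S_def by (simp add: the_inv_into_f_f bij_betw_def)
  have TS: "T (S y) = y" and SV: "S y \<in> V" if "y \<in> W" for y
    using T(1) that unfolding S_def
    by (auto simp: bij_betw_def f_the_inv_into_f the_inv_into_into)
  have TW: "T x \<in> W" if "x \<in> V" for x using T(1) that by (auto simp: bij_betw_def)
  have "S (x + y) = S x + S y" if "x \<in> W" "y \<in> W" for x y
    using ST[OF V.subspace_add[OF V(2) SV SV]] T(2) TS that SV by (simp add: linear_on_def)
  moreover have "S (sc2 c x) = sc1 c (S x)" if "x \<in> W" for c x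
    using ST[OF V.subspace_scale[OF V(2) SV]] T(2) TS that SV by (simp add: linear_on_def)
  ultimately have S: "linear_on sc2 W sc1 S" by (simp add: linear_on_def)
  have lS: "linear_on sc2 W (*) (\<lambda>y. l i (S y))" if "i \<in> I" for i
    using S l[OF that] SV by (simp add: linear_on_def)
  have TP: "linear_on sc1 V sc2 (\<lambda>x. T (P x))"
    using T(2) P by (simp add: linear_on_def)
  have mTP: "linear_on sc1 V (*) (\<lambda>x. m j (T (P x)))" if "j \<in> J" for j
    using TP m[OF that] TW P by (simp add: linear_on_def)
  \<comment> \<open>Since \<open>Q\<close> is \<open>T\<close> after \<open>P\<close> after
    \<open>S\<close> on \<open>W\<close>, expanding \<open>S (E j)\<close> in the \<open>X i\<close>
    gives a double sum over both bases.\<close>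
  have "(\<Sum>j\<in>J. m j (Q (E j))) = (\<Sum>j\<in>J. \<Sum>i\<in>I. l i (S (E j)) * m j (T (P (X i))))"
  proof (rule sum.cong[OF refl])
    fix j assume j: "j \<in> J"
    have "m j (Q (E j)) = m j (T (P (S (E j))))"
      using Q[OF SV[OF E[OF j]]] TS[OF E[OF j]] by simp
    also have "\<dots> = m j (T (P (\<Sum>i\<in>I. sc1 (l i (S (E j))) (X i))))"
      using X_rep[OF SV[OF E[OF j]]] by simp
    also have "\<dots> = (\<Sum>i\<in>I. l i (S (E j)) * m j (T (P (X i))))"
      by (rule linear_on_sum[OF V mTP[OF j] fin(1) X])
    finally show "m j (Q (E j)) = (\<Sum>i\<in>I. l i (S (E j)) * m j (T (P (X i))))" .
  qed
  also have "\<dots> = (\<Sum>i\<in>I. \<Sum>j\<in>J. m j (T (P (X i))) * l i (S (E j)))"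
    by (subst sum.swap) (simp add: mult.commute)
  \<comment> \<open>With the sums exchanged, the inner one expands \<open>T (P (X i))\<close> in the
    \<open>E j\<close>, and \<open>S\<close> brings it back to \<open>P (X i)\<close>.\<close>
  also have "\<dots> = (\<Sum>i\<in>I. l i (P (X i)))"
  proof (rule sum.cong[OF refl])
    fix i assume i: "i \<in> I"
    have "(\<Sum>j\<in>J. m j (T (P (X i))) * l i (S (E j))) = l i (S (\<Sum>j\<in>J. sc2 (m j (T (P (X i)))) (E j)))"
      by (rule linear_on_sum[OF W lS[OF i] fin(2) E, symmetric])
    also have "\<dots> = l i (P (X i))"
      using E_rep[OF TW[OF P(1)[OF X[OF i]]]] ST[OF P(1)[OF X[OF i]]] by simp
    finally show "(\<Sum>j\<in>J. m j (T (P (X i))) * l i (S (E j))) = l i (P (X i))" .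
  qed
  finally show ?thesis ..
qed

section \<open>Direct sums of copies of a matrix representation\<close>

lemma vector_space_multiple_scale: "vector_space multiple_scale"
  by unfold_locales (auto simp: multiple_scale_def fun_eq_iff vec_eq_iff algebra_simps)

lemma sum_fun_apply: "(\<Sum>i\<in>I. f i) x = (\<Sum>i\<in>I. f i x)"
  by (induction I rule: infinite_finite_induct) auto

lemma multiple_trace:
  fixes \<rho> :: "'a \<Rightarrow> complex^'n^'n" and l :: "'i \<Rightarrow> ('a \<Rightarrow> complex) \<Rightarrow> complex"
  assumes eq: "equivalent_reps B ga_scale V \<pi> multiple_scale (multiple_space N) (multiple_rep \<rho>)"
    and V: "Modules.module.subspace ga_scale V"
    and fin: "finite I" and X: "\<And>i. i \<in> I \<Longrightarrow> X i \<in> V"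
    and l: "\<And>i. i \<in> I \<Longrightarrow> linear_on ga_scale V (*) (l i)"
    and X_rep: "\<And>x. x \<in> V \<Longrightarrow> x = (\<Sum>i\<in>I. ga_scale (l i x) (X i))"
    and g: "g \<in> carrier B"
    and lin: "linear_on ga_scale V ga_scale (\<pi> g)"
  shows "(\<Sum>i\<in>I. l i (\<pi> g (X i))) = of_nat N * trace (\<rho> g)"
proof -
  \<comment> \<open>\<open>E (k, i)\<close> is the \<open>i\<close>-th standard basis vector placed
    in the \<open>k\<close>-th copy, and \<open>m (k, i)\<close> reads off its coordinate.\<close>
  define E :: "nat \<times> 'n \<Rightarrow> nat \<Rightarrow> complex^'n" where "E = (\<lambda>(k, i) k'. if k' = k then axis i 1 else 0)"
  define m :: "nat \<times> 'n \<Rightarrow> (nat \<Rightarrow> complex^'n) \<Rightarrow> complex" where "m = (\<lambda>(k, i) v. v k $ i)"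
  interpret M: vector_space multiple_scale by (rule vector_space_multiple_scale)
  interpret A: vector_space ga_scale by (rule vector_space_ga_scale)
  from eq obtain T where T: "bij_betw T V (multiple_space N)"
      "\<forall>x\<in>V. \<forall>y\<in>V. T (x + y) = T x + T y"
      "\<forall>c. \<forall>x\<in>V. T (ga_scale c x) = multiple_scale c (T x)"
      "\<forall>g\<in>carrier B. \<forall>x\<in>V. T (\<pi> g x) = multiple_rep \<rho> g (T x)"
    and stable: "\<forall>g\<in>carrier B. \<forall>x\<in>V. \<pi> g x \<in> V"
    unfolding equivalent_reps_def by blast
  have "(\<Sum>i\<in>I. l i (\<pi> g (X i))) = (\<Sum>j\<in>{..<N} \<times> UNIV. m j (multiple_rep \<rho> g (E j)))"
  proof (rule trace_transport[where T = T and W = "multiple_space N" and ?sc2.0 = multiple_scale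
        and l = l and P = "\<pi> g" and m = m and Q = "multiple_rep \<rho> g" and E = E,
        OF A.module_axioms V M.module_axioms _ fin _ X])
    show "M.subspace (multiple_space N)"
      by (auto simp: M.subspace_def multiple_space_def multiple_scale_def)
    show "y = (\<Sum>j\<in>{..<N} \<times> UNIV. multiple_scale (m j y) (E j))" if "y \<in> multiple_space N"
      for y :: "nat \<Rightarrow> complex^'n"
    proof (intro ext vec_eq_iff[THEN iffD2] allI)
      fix k :: nat and i :: 'n
      have "(\<Sum>j\<in>{..<N} \<times> UNIV. multiple_scale (m j y) (E j)) k $ i =
          (\<Sum>j\<in>{..<N} \<times> UNIV. if j = (k, i) then y k $ i else 0)"
        unfolding sum_fun_apply sum_component
        by (rule sum.cong) (auto simp: multiple_scale_def m_def E_def axis_def split: if_splits)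
      \<comment> \<open>For \<open>k \<ge> N\<close> the index \<open>(k, i)\<close> is outside the
        range of summation, but then \<open>y k = 0\<close>.\<close>
      also have "\<dots> = y k $ i"
        using that by (auto simp: multiple_space_def)
      finally show "y k $ i = (\<Sum>j\<in>{..<N} \<times> UNIV. multiple_scale (m j y) (E j)) k $ i" ..
    qed
    show "x = (\<Sum>i\<in>I. ga_scale (l i x) (X i))" if "x \<in> V" for x
      by (rule X_rep[OF that])
    show "T (\<pi> g x) = multiple_rep \<rho> g (T x)" if "x \<in> V" for x
      using T(4) g that by blast
    show "linear_on ga_scale V multiple_scale T"
      using T(2,3) by (simp add: linear_on_def)
    show "linear_on multiple_scale (multiple_space N) (*) (m j)" for j
      by (auto simp: linear_on_def m_def multiple_scale_def split: prod.split)
    show "E j \<in> multiple_space N" if "j \<in> {..<N} \<times> UNIV" for j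
      using that by (auto simp: multiple_space_def E_def)
  qed (use T(1) stable g l lin in auto)
  also have "\<dots> = (\<Sum>(k,i)\<in>{..<N} \<times> UNIV. \<rho> g $ i $ i)"
    by (intro sum.cong)
      (auto simp: m_def E_def multiple_rep_def matrix_vector_mult_def axis_def if_distrib cong: if_cong)
  also have "\<dots> = of_nat N * trace (\<rho> g)"
    by (simp add: trace_def flip: sum.cartesian_product)
  finally show ?thesis .
qed

section \<open>Odd-order groups of class 2 and their Lie rings\<close>

locale odd_class2_group = group B for B (structure) +
  assumes nilpotent: "nilpotency_class_2 B"
    and finite_carrier: "finite (carrier B)"
    and odd_order: "odd (order B)"
begin

abbreviation Z where "Z \<equiv> group_center B"

definition commutator where "commutator x y = x \<otimes> y \<otimes> inv x \<otimes> inv y"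

text \<open>For odd order the exponent doubles to \<open>order B + 1\<close>, so the square is
  \<open>x\<close> by Lagrange. Being a fixed power, \<open>sqroot\<close> preserves the centre and
  commutes with homomorphisms.\<close>

definition sqroot where "sqroot x = x [^] ((order B + 1) div 2)"

section \<open>The centre and the abelian quotient by it\<close>

lemma Z_carrier: "z \<in> Z \<Longrightarrow> z \<in> carrier B"
  by (simp add: group_center_def)

lemma Z_commute: "z \<in> Z \<Longrightarrow> x \<in> carrier B \<Longrightarrow> x \<otimes> z = z \<otimes> x"
  by (simp add: group_center_def)

lemma Z_left_commute:
  "z \<in> Z \<Longrightarrow> x \<in> carrier B \<Longrightarrow> y \<in> carrier B \<Longrightarrow> x \<otimes> (z \<otimes> y) = z \<otimes> (x \<otimes> y)"
  by (metis Z_carrier Z_commute m_assoc)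

lemma Z_subgroup: "subgroup Z B"
proof (rule subgroupI)
  show "Z \<subseteq> carrier B" by (auto simp: group_center_def)
  show "Z \<noteq> {}" by (auto simp: group_center_def intro!: exI[of _ \<one>])
next
  fix a assume a: "a \<in> Z"
  have "inv a \<otimes> x = x \<otimes> inv a" if "x \<in> carrier B" for x
    using that a Z_carrier[OF a] Z_commute[OF a]
    by (metis inv_closed inv_equality inv_solve_left' inv_solve_right m_assoc m_closed)
  then show "inv a \<in> Z" using Z_carrier[OF a] by (simp add: group_center_def)
next
  fix a b assume ab: "a \<in> Z" "b \<in> Z"
  have "a \<otimes> b \<otimes> x = x \<otimes> (a \<otimes> b)" if "x \<in> carrier B" for x
    using that ab[THEN Z_carrier] Z_commute[OF ab(2) that] Z_left_commute[OF ab(1) that]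
    by (simp add: m_assoc)
  then show "a \<otimes> b \<in> Z"
    using ab[THEN Z_carrier] by (simp add: group_center_def)
qed

lemma Z_normal: "Z \<lhd> B"
  by (rule normal_invI[OF Z_subgroup])
    (metis Z_carrier Z_commute inv_closed inv_solve_right m_closed)

lemmas Z_mult = subgroup.m_closed[OF Z_subgroup]
lemmas Z_one = subgroup.one_closed[OF Z_subgroup]
lemmas Z_inv = subgroup.m_inv_closed[OF Z_subgroup]

lemma Z_pow: "z \<in> Z \<Longrightarrow> z [^] (n::nat) \<in> Z"
  by (induction n) (auto simp: Z_one Z_mult)

lemma C_part_mult:
  assumes "x \<in> carrier B" "y \<in> carrier B"
  shows "C_part B x \<otimes>\<^bsub>B Mod Z\<^esub> C_part B y = C_part B (x \<otimes> y)"
  using normal.rcos_sum[OF Z_normal assms] by (simp add: C_part_def FactGroup_def)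

lemma C_part_closed: "x \<in> carrier B \<Longrightarrow> C_part B x \<in> carrier (B Mod Z)"
  by (auto simp: C_part_def FactGroup_def RCOSETS_def)

text \<open>Nilpotency class 2 enters here: it makes every commutator central.\<close>

lemma C_part_commute:
  assumes "x \<in> carrier B" "y \<in> carrier B"
  shows "C_part B (x \<otimes> y) = C_part B (y \<otimes> x)"
proof -
  interpret Q: comm_group "B Mod Z"
    using nilpotent by (simp add: nilpotency_class_2_def)
  show ?thesis
    using Q.m_comm C_part_mult C_part_closed assms by metis
qed

lemma C_part_eqD:
  assumes "x \<in> carrier B" "y \<in> carrier B" "C_part B x = C_part B y"
  shows "x \<otimes> inv y \<in> Z"
  using assms rcos_self[OF _ Z_subgroup, of x] subgroup.rcos_module[OF Z_subgroup is_group, of y x]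
  by (simp add: C_part_def)

section \<open>Commutator calculus in class 2\<close>

lemma commutator_Z: "x \<in> carrier B \<Longrightarrow> y \<in> carrier B \<Longrightarrow> commutator x y \<in> Z"
  using C_part_eqD[OF _ _ C_part_commute[of x y]]
  by (simp add: commutator_def inv_mult_group m_assoc)

lemma commutator_closed: "x \<in> carrier B \<Longrightarrow> y \<in> carrier B \<Longrightarrow> commutator x y \<in> carrier B"
  by (simp add: commutator_def)

lemma commutator_swap: "x \<in> carrier B \<Longrightarrow> y \<in> carrier B \<Longrightarrow> x \<otimes> y = commutator x y \<otimes> (y \<otimes> x)"
  unfolding commutator_def by (simp add: m_assoc) (simp flip: m_assoc)

text \<open>Cancel \<open>y \<otimes> x\<close>. Commutators below are computed by exhibiting the
  factor that arises when two elements are interchanged.\<close>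

lemma commutator_unique:
  assumes "x \<in> carrier B" "y \<in> carrier B" "k \<in> carrier B" "x \<otimes> y = k \<otimes> (y \<otimes> x)"
  shows "commutator x y = k"
  by (metis assms commutator_closed commutator_swap m_closed right_cancel)

text \<open>Moving \<open>x\<close> past \<open>y\<close> and then past \<open>z\<close> produces
  one commutator each time; both are central and can be collected in front.\<close>

lemma commutator_mult_right:
  assumes x: "x \<in> carrier B" and y: "y \<in> carrier B" and z: "z \<in> carrier B"
  shows "commutator x (y \<otimes> z) = commutator x y \<otimes> commutator x z"
proof (rule commutator_unique)
  have "x \<otimes> (y \<otimes> z) = commutator x y \<otimes> (y \<otimes> (x \<otimes> z))"
    using commutator_swap[OF x y] assms by (metis commutator_closed m_assoc m_closed)
  also have "x \<otimes> z = commutator x z \<otimes> (z \<otimes> x)"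
    by (rule commutator_swap[OF x z])
  finally show "x \<otimes> (y \<otimes> z) = commutator x y \<otimes> commutator x z \<otimes> ((y \<otimes> z) \<otimes> x)"
    using assms commutator_closed by (simp add: Z_left_commute[OF commutator_Z[OF x z] y] m_assoc)
qed (use assms commutator_closed in auto)

lemma commutator_inv:
  assumes x: "x \<in> carrier B" and y: "y \<in> carrier B"
  shows "commutator y x = inv (commutator x y)"
  using assms by (simp add: commutator_def inv_mult_group m_assoc)

lemma commutator_mult_left:
  assumes x: "x \<in> carrier B" and y: "y \<in> carrier B" and z: "z \<in> carrier B"
  shows "commutator (y \<otimes> z) x = commutator y x \<otimes> commutator z x"
  using commutator_mult_right[OF assms] Z_commute[OF Z_inv[OF commutator_Z[OF x y]], of "inv (commutator x z)"]
  by (simp add: commutator_inv[OF x] assms inv_mult_group commutator_closed)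

lemma commutator_central_right: "x \<in> carrier B \<Longrightarrow> z \<in> Z \<Longrightarrow> commutator x z = \<one>"
  by (rule commutator_unique) (simp_all add: Z_carrier Z_commute[of z x])

lemma commutator_central_left: "x \<in> carrier B \<Longrightarrow> z \<in> Z \<Longrightarrow> commutator z x = \<one>"
  by (rule commutator_unique) (simp_all add: Z_carrier Z_commute[of z x])

lemma commutator_pow_right:
  "x \<in> carrier B \<Longrightarrow> y \<in> carrier B \<Longrightarrow> commutator x (y [^] (n::nat)) = commutator x y [^] n"
  by (induction n) (simp_all add: commutator_mult_right commutator_central_right Z_one)

lemma commutator_sqroot: "x \<in> carrier B \<Longrightarrow> y \<in> carrier B \<Longrightarrow> commutator x (sqroot y) = sqroot (commutator x y)"
  by (simp add: sqroot_def commutator_pow_right)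

lemma commutator_inv_right:
  assumes "x \<in> carrier B" "y \<in> carrier B"
  shows "commutator x (inv y) = inv (commutator x y)"
  using commutator_mult_right[OF assms(1) assms(2), of "inv y"] assms
  by (metis commutator_central_right commutator_closed inv_closed inv_equality inv_inv Z_one r_inv)

section \<open>Square roots and halves\<close>

lemma sqroot_closed: "x \<in> carrier B \<Longrightarrow> sqroot x \<in> carrier B"
  by (simp add: sqroot_def)

lemma sqroot_Z: "x \<in> Z \<Longrightarrow> sqroot x \<in> Z"
  by (simp add: sqroot_def Z_pow)

lemma sqroot_square:
  assumes "x \<in> carrier B" shows "sqroot x \<otimes> sqroot x = x"
proof -
  have "sqroot x \<otimes> sqroot x = x [^] (order B + 1)"
    unfolding sqroot_def nat_pow_mult[OF assms] using odd_order
    by (simp add: odd_two_times_div_two_succ flip: mult_2)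
  also have "\<dots> = x"
    using assms pow_order_eq_1[OF assms] by simp
  finally show ?thesis .
qed

text \<open>\<open>sqroot\<close> is also a left inverse of squaring, because \<open>z\<close>
  commutes with itself.\<close>

lemma square_inj:
  assumes "x \<in> carrier B" "y \<in> carrier B" "x \<otimes> x = y \<otimes> y"
  shows "x = y"
proof -
  have "sqroot (z \<otimes> z) = z" if z: "z \<in> carrier B" for z
  proof -
    have "sqroot (z \<otimes> z) = sqroot z \<otimes> sqroot z"
      using pow_mult_distrib[of z z] z by (simp add: sqroot_def)
    then show ?thesis using sqroot_square[OF z] by simp
  qed
  then show ?thesis using assms by metis
qed

text \<open>Injectivity of squaring gives \<open>the_inv_into\<close> its meaning. In the
  computation of \<open>phi\<close> the argument is brought into this form of an explicit
  square.\<close>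

lemma center_half_square:
  assumes "a \<in> Z" shows "center_half B (a \<otimes> a) = a"
proof -
  have "inj_on (\<lambda>a. a \<otimes> a) Z"
    using square_inj Z_carrier by (intro inj_onI) blast
  from the_inv_into_f_f[OF this assms] show ?thesis
    by (simp add: center_half_def)
qed

end

locale odd_class2_group_section = odd_class2_group +
  fixes s :: "'a set \<Rightarrow> 'a"
  assumes sec: "is_section B s"
begin

abbreviation lie_add where "lie_add \<equiv> mult (lie_ring_of B s)"

section \<open>The addition of the Lie ring in terms of the group product\<close>

lemma section_closed: "x \<in> carrier B \<Longrightarrow> s (C_part B x) \<in> carrier B"
  using sec C_part_closed by (simp add: is_section_def)

lemma C_part_section: "x \<in> carrier B \<Longrightarrow> C_part B (s (C_part B x)) = C_part B x"
  using sec C_part_closed[of x] by (simp add: is_section_def C_part_def)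

text \<open>The two values of \<open>psi\<close> are \<open>k \<otimes> p\<close> and
  \<open>p\<close>, where \<open>k\<close> is the commutator of the representatives. Their product
  is the square of \<open>sqroot k \<otimes> p\<close>, which is therefore \<open>phi\<close>. Then
  \<open>p \<otimes> w\<close> recombines to \<open>v \<otimes> u\<close>, and the section drops
  out.\<close>

lemma lie_add_eq:
  assumes x: "x \<in> carrier B" and y: "y \<in> carrier B"
  shows "lie_add x y = sqroot (commutator x y) \<otimes> (y \<otimes> x)"
proof -
  define u v w a b k q where "u = s (C_part B x)" "v = s (C_part B y)" "w = s (C_part B (x \<otimes> y))"
    "a = x \<otimes> inv u" "b = y \<otimes> inv v" "k = commutator u v" "q = sqroot k"
  note defs = this
  have c: "u \<in> carrier B" "v \<in> carrier B" "w \<in> carrier B"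
    using section_closed assms by (simp_all add: defs(1-3))
  have a: "a \<in> Z" and b: "b \<in> Z"
    unfolding defs(4,5) using assms c C_part_section
    by (auto intro!: C_part_eqD simp: defs(1-3))
  note ac = a[THEN Z_carrier] b[THEN Z_carrier]
  have xy: "x = a \<otimes> u" "y = b \<otimes> v"
    using assms c by (simp_all add: defs(4,5) m_assoc)
  have k: "k \<in> Z" "q \<in> Z" "k = q \<otimes> q"
    using commutator_Z[OF c(1,2)] sqroot_Z sqroot_square[of k] Z_carrier by (auto simp: defs(6,7))
  note kc = k(1,2)[THEN Z_carrier]
  \<comment> \<open>The central factors \<open>a\<close> and \<open>b\<close> do not affect the
    commutator.\<close>
  have comm_xy: "commutator x y = k"
    unfolding xy using c ac
    by (simp add: commutator_mult_left commutator_mult_right commutator_central_left[OF _ a]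
        commutator_central_right[OF _ b] defs(6) commutator_closed)
  define p where "p = v \<otimes> u \<otimes> inv w"
  have cuv: "C_part B (v \<otimes> u) = C_part B (x \<otimes> y)"
    by (metis C_part_commute C_part_mult C_part_section c(1,2) defs(1,2) x y)
  then have p: "p \<in> Z"
    unfolding p_def using c C_part_section[of "x \<otimes> y"] x y by (intro C_part_eqD) (simp_all add: defs(3))
  note pc = p[THEN Z_carrier]
  have vu: "v \<otimes> u = p \<otimes> w" unfolding p_def using c by (simp add: m_assoc)
  have psi1: "psi B s (C_part B x) (C_part B y) = k \<otimes> p"
    unfolding psi_def C_part_mult[OF x y] defs(1-3)[symmetric]
    using commutator_swap[OF c(1,2)] c kc by (simp add: p_def defs(6) m_assoc)
  have psi2: "psi B s (C_part B y) (C_part B x) = p"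
    unfolding psi_def C_part_mult[OF y x] C_part_commute[OF y x] defs(1-3)[symmetric] p_def ..
  have "k \<otimes> p \<otimes> p = (q \<otimes> p) \<otimes> (q \<otimes> p)"
    unfolding k(3) using kc pc by (simp add: m_assoc Z_left_commute[OF k(2) pc])
  then have phi: "phi B s (C_part B x) (C_part B y) = q \<otimes> p"
    unfolding phi_def psi1 psi2 using center_half_square[OF Z_mult[OF k(2) p]] by simp
  have "lie_add x y = a \<otimes> b \<otimes> (q \<otimes> p) \<otimes> w"
    unfolding lie_ring_of_def monoid.simps phi A_part_def C_part_mult[OF x y] defs(1-3)[symmetric]
      defs(4,5)[symmetric] ..
  also have "\<dots> = a \<otimes> b \<otimes> q \<otimes> (v \<otimes> u)"
    unfolding vu using ac kc pc c by (simp add: m_assoc)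
  also have "\<dots> = q \<otimes> (y \<otimes> x)"
    unfolding xy using ac kc pc c
    by (simp add: m_assoc Z_left_commute[OF k(2) ac(1)] Z_left_commute[OF k(2) ac(2)]
        Z_left_commute[OF a c(2)] Z_left_commute[OF a ac(2)])
  finally show ?thesis unfolding comm_xy defs(7) .
qed

lemma mult_eq_lie_add:
  assumes x: "x \<in> carrier B" and y: "y \<in> carrier B"
  shows "x \<otimes> y = sqroot (commutator x y) \<otimes> lie_add x y"
proof -
  have "x \<otimes> y = sqroot (commutator x y) \<otimes> sqroot (commutator x y) \<otimes> (y \<otimes> x)"
    unfolding sqroot_square[OF commutator_closed[OF x y]] by (rule commutator_swap[OF x y])
  then show ?thesis
    unfolding lie_add_eq[OF x y] using assms by (simp add: m_assoc sqroot_closed commutator_closed)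
qed

lemma lie_add_central:
  assumes z: "z \<in> Z" and y: "y \<in> carrier B"
  shows "lie_add z y = z \<otimes> y"
  using mult_eq_lie_add[OF Z_carrier[OF z] y] lie_add_eq[OF Z_carrier[OF z] y]
  by (simp add: commutator_central_left z y sqroot_def Z_carrier)

lemma lie_add_closed: "x \<in> carrier B \<Longrightarrow> y \<in> carrier B \<Longrightarrow> lie_add x y \<in> carrier B"
  by (simp add: lie_add_eq sqroot_closed commutator_closed)

text \<open>The square root in \<open>lie_add_eq\<close> is central and contributes nothing. So the
  commutator with \<open>g\<close> is additive on the Lie ring too, which makes the coadjoint action
  preserve characters.\<close>

lemma commutator_lie_add:
  assumes x: "x \<in> carrier B" and y: "y \<in> carrier B" and g: "g \<in> carrier B"
  shows "commutator (lie_add x y) g = commutator x g \<otimes> commutator y g"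
  using assms commutator_closed Z_commute[OF commutator_Z[OF x g] commutator_closed[OF y g]]
  by (simp add: lie_add_eq commutator_mult_left sqroot_closed
      commutator_central_left[OF g sqroot_Z[OF commutator_Z[OF x y]]])

section \<open>Unitary characters of the Lie ring\<close>

lemma lie_carrier [simp]: "carrier (lie_ring_of B s) = carrier B"
  by (simp add: lie_ring_of_def)

lemma lie_dualD:
  assumes "chi \<in> lie_dual B s"
  shows "x \<in> carrier B \<Longrightarrow> norm (chi x) = 1"
    and "x \<in> carrier B \<Longrightarrow> y \<in> carrier B \<Longrightarrow> chi (lie_add x y) = chi x * chi y"
    and "chi \<in> extensional (carrier B)"
  using assms by (auto simp: unitary_characters_def hom_def circle_group_def)

lemma char_nonzero: "chi \<in> lie_dual B s \<Longrightarrow> x \<in> carrier B \<Longrightarrow> chi x \<noteq> 0"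
  using lie_dualD(1) by fastforce

lemma char_central_mult:
  "chi \<in> lie_dual B s \<Longrightarrow> z \<in> Z \<Longrightarrow> y \<in> carrier B \<Longrightarrow> chi (z \<otimes> y) = chi z * chi y"
  using lie_dualD(2) lie_add_central Z_carrier by metis

lemma char_one: "chi \<in> lie_dual B s \<Longrightarrow> chi \<one> = 1"
  using char_central_mult[of chi \<one> \<one>] char_nonzero[of chi \<one>] Z_one by simp

lemma char_central_inv:
  "chi \<in> lie_dual B s \<Longrightarrow> z \<in> Z \<Longrightarrow> chi (inv z) = cnj (chi z)"
proof -
  assume *: "chi \<in> lie_dual B s" "z \<in> Z"
  then have "chi z * chi (inv z) = 1"
    using char_central_mult[of chi z "inv z"] char_one[of chi] Z_carrier by simp
  moreover have "chi z * cnj (chi z) = 1"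
    using lie_dualD(1)[OF *(1) Z_carrier[OF *(2)]] by (simp add: complex_norm_square[symmetric])
  ultimately show ?thesis
    using char_nonzero[OF *(1) Z_carrier[OF *(2)]] by (metis mult_left_cancel)
qed

lemma char_central_pow:
  "chi \<in> lie_dual B s \<Longrightarrow> z \<in> Z \<Longrightarrow> chi (z [^] (n::nat)) = chi z ^ n"
  by (induction n) (simp_all add: char_one char_central_mult Z_pow Z_carrier)

text \<open>The central factor in \<open>mult_eq_lie_add\<close> splits off, and \<open>chi\<close>
  is multiplicative on the remaining sum.\<close>

lemma char_mult:
  "chi \<in> lie_dual B s \<Longrightarrow> x \<in> carrier B \<Longrightarrow> y \<in> carrier B \<Longrightarrow>
    chi (x \<otimes> y) = chi (sqroot (commutator x y)) * (chi x * chi y)"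
  by (simp add: mult_eq_lie_add char_central_mult sqroot_Z commutator_Z lie_add_closed lie_dualD(2))

section \<open>The coadjoint representation\<close>

text \<open>Conjugation by \<open>inv g\<close> multiplies \<open>h\<close> by the central element
  \<open>commutator h g\<close>. Thus \<open>g\<close> twists \<open>chi\<close> by a factor that
  depends only on the values of \<open>chi\<close> on the centre.\<close>

lemma coAd_apply:
  assumes "chi \<in> lie_dual B s" and g: "g \<in> carrier B" and h: "h \<in> carrier B"
  shows "coAd B s g chi h = chi (commutator h g) * chi h"
proof -
  have "inv g \<otimes> (h \<otimes> g) = commutator h g \<otimes> (inv g \<otimes> (g \<otimes> h))"
    unfolding commutator_swap[OF h g] using g h by (intro Z_left_commute commutator_Z) auto
  then have "Ad B (inv g) h = commutator h g \<otimes> h"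
    using g h by (simp add: Ad_def m_assoc) (simp flip: m_assoc)
  then show ?thesis
    using assms by (simp add: coAd_def char_central_mult commutator_Z)
qed

lemma coAd_closed:
  assumes "chi \<in> lie_dual B s" and g: "g \<in> carrier B"
  shows "coAd B s g chi \<in> lie_dual B s"
proof -
  have ext: "coAd B s g chi \<in> extensional (carrier B)"
    using assms by (simp add: coAd_def)
  show ?thesis
    unfolding unitary_characters_def hom_def circle_group_def
    using assms ext
    by (auto simp: coAd_apply lie_add_closed commutator_lie_add char_central_mult commutator_Z commutator_closed
        lie_dualD norm_mult)
qed

lemma coAd_eq_iff:
  assumes "chi \<in> lie_dual B s" and "g \<in> carrier B" "g' \<in> carrier B"
  shows "coAd B s g chi = coAd B s g' chi \<longleftrightarrow> (\<forall>h\<in>carrier B. chi (commutator h g) = chi (commutator h g'))"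
proof
  assume "coAd B s g chi = coAd B s g' chi"
  then show "\<forall>h\<in>carrier B. chi (commutator h g) = chi (commutator h g')"
    using coAd_apply assms char_nonzero by (metis mult_right_cancel)
next
  assume "\<forall>h\<in>carrier B. chi (commutator h g) = chi (commutator h g')"
  then show "coAd B s g chi = coAd B s g' chi"
    using coAd_apply assms lie_dualD(3)[OF coAd_closed]
    by (intro extensionalityI[of _ "carrier B"]) auto
qed

section \<open>The regular representation on an orbit space\<close>

lemma coAd_one: "chi \<in> lie_dual B s \<Longrightarrow> coAd B s \<one> chi = chi"
  using lie_dualD(3)[OF coAd_closed] lie_dualD(3)
  by (intro extensionalityI[of _ "carrier B"]) (auto simp: coAd_apply commutator_central_right Z_one char_one)

lemma coAd_central:
  "chi \<in> lie_dual B s \<Longrightarrow> g \<in> carrier B \<Longrightarrow> z \<in> Z \<Longrightarrow> coAd B s g chi z = chi z"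
  by (simp add: coAd_apply Z_carrier commutator_central_left char_one)

text \<open>The inner action does not change \<open>chi\<close> at the central element
  \<open>commutator h g\<close>, so the two twists simply multiply.\<close>

lemma coAd_coAd:
  assumes chi: "chi \<in> lie_dual B s" and g: "g \<in> carrier B" and g': "g' \<in> carrier B"
  shows "coAd B s g (coAd B s g' chi) = coAd B s (g \<otimes> g') chi"
proof (rule extensionalityI[of _ "carrier B"])
  fix h assume h: "h \<in> carrier B"
  have "coAd B s g (coAd B s g' chi) h = chi (commutator h g) * (chi (commutator h g') * chi h)"
    by (simp only: coAd_apply[OF coAd_closed[OF chi g'] g h] coAd_central[OF chi g' commutator_Z[OF h g]]
        coAd_apply[OF chi g' h])
  then show "coAd B s g (coAd B s g' chi) h = coAd B s (g \<otimes> g') chi h"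
    using h g g' chi
    by (simp add: coAd_apply commutator_mult_right char_central_mult commutator_Z commutator_closed)
qed (use assms lie_dualD(3) coAd_closed in auto)

lemma orbit_eq:
  assumes chi: "chi \<in> lie_dual B s" and g: "g \<in> carrier B"
  shows "orbit B (coAd B s) (coAd B s g chi) = orbit B (coAd B s) chi"
proof
  show "orbit B (coAd B s) (coAd B s g chi) \<subseteq> orbit B (coAd B s) chi"
    using assms by (auto simp: orbit_def coAd_coAd)
  show "orbit B (coAd B s) chi \<subseteq> orbit B (coAd B s) (coAd B s g chi)"
  proof
    fix c assume "c \<in> orbit B (coAd B s) chi"
    then obtain g' where g': "g' \<in> carrier B" "c = coAd B s g' chi" by (auto simp: orbit_def)
    then have "c = coAd B s (g' \<otimes> inv g) (coAd B s g chi)"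
      using assms by (simp add: coAd_coAd m_assoc)
    then show "c \<in> orbit B (coAd B s) (coAd B s g chi)"
      using g g' by (auto simp: orbit_def)
  qed
qed

section \<open>Stabilizers along an orbit\<close>

lemma stabilizer_iff:
  assumes "chi \<in> lie_dual B s"
  shows "b \<in> stabilizer B (coAd B s) chi \<longleftrightarrow> b \<in> carrier B \<and> (\<forall>h\<in>carrier B. chi (commutator h b) = 1)"
  using coAd_eq_iff[OF assms, of b \<one>] assms
  by (auto simp: stabilizer_def coAd_one commutator_central_right Z_one char_one)

text \<open>For central \<open>z\<close>, \<open>chi z\<close> is the square of
  \<open>chi (sqroot z)\<close>, and \<open>chi (sqroot z)\<close> is a power of
  \<open>chi z\<close>; so one is 1 iff the other is.\<close>

lemma stabilizer_sqroot_iff: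
  assumes chi: "chi \<in> lie_dual B s" and b: "b \<in> carrier B"
  shows "sqroot b \<in> stabilizer B (coAd B s) chi \<longleftrightarrow> b \<in> stabilizer B (coAd B s) chi"
proof -
  have "chi (sqroot z) = 1 \<longleftrightarrow> chi z = 1" if z: "z \<in> Z" for z
  proof
    assume "chi (sqroot z) = 1"
    then show "chi z = 1"
      using char_central_mult[OF chi sqroot_Z[OF z] sqroot_closed[OF Z_carrier[OF z]]]
        sqroot_square[OF Z_carrier[OF z]]
      by simp
  qed (simp add: sqroot_def char_central_pow[OF chi z])
  then show ?thesis
    using b by (simp add: stabilizer_iff[OF chi] sqroot_closed commutator_sqroot commutator_Z)
qed

text \<open>Membership is a condition on values at commutators, which are central, and there the
  whole orbit agrees.\<close>

lemma stabilizer_coAd: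
  assumes "chi \<in> lie_dual B s" "g \<in> carrier B"
  shows "stabilizer B (coAd B s) (coAd B s g chi) = stabilizer B (coAd B s) chi"
  using assms by (auto simp: stabilizer_iff coAd_closed coAd_central commutator_Z)

text \<open>The twist at \<open>b\<close> is the conjugate of \<open>chi (commutator g b)\<close>,
  which is 1. This makes all diagonal entries of the later trace equal.\<close>

lemma coAd_stabilizer_apply:
  assumes "chi \<in> lie_dual B s" "g \<in> carrier B" "b \<in> stabilizer B (coAd B s) chi"
  shows "coAd B s g chi b = chi b"
proof -
  have b: "b \<in> carrier B" and "chi (commutator g b) = 1"
    using assms by (auto simp: stabilizer_iff)
  then show ?thesis
    using assms(1,2) by (simp add: coAd_apply commutator_inv[of g b] char_central_inv commutator_Z)
qed

section \<open>Orthogonality and coordinates\<close>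

lemma sum_char_commutator:
  assumes chi: "chi \<in> lie_dual B s" and g: "g \<in> carrier B"
  shows "(\<Sum>h\<in>carrier B. chi (commutator h g)) =
    (if \<forall>h\<in>carrier B. chi (commutator h g) = 1 then of_nat (order B) else 0)"
proof (cases "\<forall>h\<in>carrier B. chi (commutator h g) = 1")
  case False
  then obtain k where k: "k \<in> carrier B" "chi (commutator k g) \<noteq> 1" by blast
  \<comment> \<open>Translating by \<open>k\<close> multiplies the sum by
    \<open>chi (commutator k g) \<noteq> 1\<close>, so it vanishes.\<close>
  have "(\<Sum>h\<in>carrier B. chi (commutator h g)) = (\<Sum>h\<in>carrier B. chi (commutator (k \<otimes> h) g))"
    by (rule sum.reindex_bij_betw[symmetric])
      (use inj_on_cmult[OF k(1)] surj_const_mult[OF k(1)] in \<open>auto simp: bij_betw_def\<close>)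
  also have "\<dots> = chi (commutator k g) * (\<Sum>h\<in>carrier B. chi (commutator h g))"
    using k g chi by (simp add: commutator_mult_left char_central_mult commutator_Z commutator_closed sum_distrib_left)
  finally show ?thesis using k by auto
qed (simp add: order_def)

text \<open>The normalised Hermitian product with \<open>chi\<close>, conjugated in
  \<open>chi\<close> so as to be linear in \<open>x\<close>. It is the coordinate along
  \<open>X_elem B chi\<close>.\<close>

definition char_coord :: "('a \<Rightarrow> complex) \<Rightarrow> ('a \<Rightarrow> complex) \<Rightarrow> complex" where
  "char_coord chi x = (\<Sum>h\<in>carrier B. cnj (chi h) * x h) / of_nat (order B)"

lemma char_coord_linear:
  "char_coord chi (x + y) = char_coord chi x + char_coord chi y"
  "char_coord chi (ga_scale c x) = c * char_coord chi x"
  by (simp_all add: char_coord_def ga_scale_def algebra_simps sum.distrib add_divide_distrib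
      sum_distrib_left)

lemma X_elem_apply: "X_elem B chi h = (if h \<in> carrier B then chi h else 0)"
  using finite_carrier
  by (auto simp: X_elem_def sum_fun_apply ga_scale_def ga_of_def if_distrib cong: if_cong)

text \<open>Since \<open>chi h\<close> has modulus 1, the product of the two twisted characters
  reduces to \<open>chi (commutator h (inv g \<otimes> g'))\<close>, and
  \<open>sum_char_commutator\<close> applies.\<close>

lemma char_coord_X_elem:
  assumes chi: "chi \<in> lie_dual B s" and g: "g \<in> carrier B" and g': "g' \<in> carrier B"
  shows "char_coord (coAd B s g chi) (X_elem B (coAd B s g' chi)) =
    (if coAd B s g chi = coAd B s g' chi then 1 else 0)"
proof -
  have eq: "cnj (coAd B s g chi h) * coAd B s g' chi h = chi (commutator h (inv g \<otimes> g'))"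
    and iff: "chi (commutator h g) = chi (commutator h g') \<longleftrightarrow> chi (commutator h (inv g \<otimes> g')) = 1"
    if h: "h \<in> carrier B" for h
  proof -
    have n: "cnj (chi x) * chi x = 1" if "x \<in> carrier B" for x
      using lie_dualD(1)[OF chi that] by (simp add: mult.commute complex_norm_square[symmetric])
    have *: "chi (commutator h (inv g \<otimes> g')) = cnj (chi (commutator h g)) * chi (commutator h g')"
      using h g g' chi by (simp add: commutator_mult_right commutator_inv_right char_central_mult Z_inv commutator_Z
          commutator_closed char_central_inv)
    show "cnj (coAd B s g chi h) * coAd B s g' chi h = chi (commutator h (inv g \<otimes> g'))"
      unfolding * using h g g' chi n[OF h] by (simp add: coAd_apply mult.assoc mult.left_commute)
    show "chi (commutator h g) = chi (commutator h g') \<longleftrightarrow> chi (commutator h (inv g \<otimes> g')) = 1"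
      unfolding * using n[OF commutator_closed[OF h g]] by (metis mult_left_cancel mult_zero_left zero_neq_one)
  qed
  have "(\<Sum>h\<in>carrier B. cnj (coAd B s g chi h) * X_elem B (coAd B s g' chi) h) =
      (\<Sum>h\<in>carrier B. chi (commutator h (inv g \<otimes> g')))"
    using eq by (simp add: X_elem_apply)
  then show ?thesis
    using order_gt_0_iff_finite finite_carrier g g'
    by (simp add: char_coord_def sum_char_commutator[OF chi] coAd_eq_iff[OF chi g g'] iff)
qed

section \<open>Right translation and its trace on the orbit space\<close>

lemma regular_rep_apply:
  assumes g: "g \<in> carrier B"
  shows "regular_rep B g x h = (if h \<in> carrier B then x (h \<otimes> g) else 0)"
proof (cases "h \<in> carrier B")
  case h: True
  have "inv k \<otimes> h = inv g \<longleftrightarrow> k = h \<otimes> g" if k: "k \<in> carrier B" for k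
    using g h k by (metis inv_closed inv_inv inv_solve_left inv_solve_right m_closed)
  then have "regular_rep B g x h = (\<Sum>k\<in>carrier B. if k = h \<otimes> g then x k else 0)"
    using h by (auto simp: regular_rep_def ga_mult_def ga_of_def intro!: sum.cong)
  then show ?thesis
    using g h finite_carrier by simp
qed (simp add: regular_rep_def ga_mult_def)

text \<open>In \<open>char_mult\<close> for \<open>h \<otimes> g\<close>, the root of the commutator
  equals \<open>commutator h (sqroot g)\<close>, which is exactly the twist by
  \<open>sqroot g\<close>.\<close>

lemma regular_rep_X_elem:
  assumes chi: "chi \<in> lie_dual B s" and g: "g \<in> carrier B"
  shows "regular_rep B g (X_elem B chi) = ga_scale (chi g) (X_elem B (coAd B s (sqroot g) chi))"
  using assms
  by (auto simp: fun_eq_iff regular_rep_apply X_elem_apply ga_scale_def coAd_apply sqroot_closed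
      commutator_sqroot char_mult)

lemma sum_coords_regular_rep:
  assumes chi: "chi \<in> lie_dual B s" and b: "b \<in> carrier B"
  shows "(\<Sum>c\<in>orbit B (coAd B s) chi. char_coord c (regular_rep B b (X_elem B c))) =
    (if b \<in> stabilizer B (coAd B s) chi
     then of_nat (card (orbit B (coAd B s) chi)) * chi b else 0)"
proof -
  have "char_coord c (regular_rep B b (X_elem B c)) =
      (if b \<in> stabilizer B (coAd B s) chi then chi b else 0)"
    if in_orbit: "c \<in> orbit B (coAd B s) chi" for c
  proof -
    obtain g where g: "g \<in> carrier B" "c = coAd B s g chi"
      using in_orbit by (auto simp: orbit_def)
    have c: "c \<in> lie_dual B s" using coAd_closed chi g by simp
    \<comment> \<open>Writing \<open>c\<close> as \<open>coAd B s \<one> c\<close> brings both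
      characters into the form of \<open>char_coord_X_elem\<close> with base point
      \<open>c\<close>.\<close>
    have "char_coord c (regular_rep B b (X_elem B c)) =
        c b * char_coord (coAd B s \<one> c) (X_elem B (coAd B s (sqroot b) c))"
      using c b by (simp add: regular_rep_X_elem char_coord_linear coAd_one)
    also have "\<dots> = (if sqroot b \<in> stabilizer B (coAd B s) c then c b else 0)"
      using b unfolding char_coord_X_elem[OF c one_closed sqroot_closed[OF b]]
      by (auto simp: coAd_one[OF c] sqroot_closed stabilizer_def)
    also have "\<dots> = (if b \<in> stabilizer B (coAd B s) chi then chi b else 0)"
      using stabilizer_sqroot_iff[OF c b] coAd_stabilizer_apply[OF chi g(1)]
      by (simp add: g(2) stabilizer_coAd[OF chi g(1)])
    finally show ?thesis .
  qed
  then show ?thesis by simp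
qed

text \<open>Both sides are linear in \<open>x\<close>; on a spanning element orthonormality leaves a
  single term.\<close>

lemma V_space_representation:
  assumes chi: "chi \<in> lie_dual B s" and x: "x \<in> V_space B (orbit B (coAd B s) chi)"
  shows "x = (\<Sum>c\<in>orbit B (coAd B s) chi. ga_scale (char_coord c x) (X_elem B c))"
proof -
  let ?r = "\<lambda>x. \<Sum>c\<in>orbit B (coAd B s) chi. ga_scale (char_coord c x) (X_elem B c)"
  interpret A: vector_space ga_scale by (rule vector_space_ga_scale)
  have fin: "finite (orbit B (coAd B s) chi)"
    using finite_carrier by (simp add: orbit_def)
  show ?thesis
  proof (rule A.span_induct[OF x[unfolded V_space_def]])
    have zero: "char_coord c 0 = 0" for c
      by (simp add: char_coord_def)
    have add: "?r (x + y) = ?r x + ?r y" for x y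
      by (simp add: char_coord_linear A.scale_left_distrib sum.distrib)
    have scale: "?r (ga_scale k x) = ga_scale k (?r x)" for k x
      by (simp add: char_coord_linear A.scale_sum_right)
    show "A.subspace {x. x = ?r x}"
      unfolding A.subspace_def mem_Collect_eq
    proof (intro conjI allI ballI impI)
      show "0 = ?r 0" by (simp add: zero)
    qed (simp only: mem_Collect_eq add scale; metis)+
  next
    fix x assume "x \<in> X_elem B ` orbit B (coAd B s) chi"
    then obtain d where d: "d \<in> orbit B (coAd B s) chi" "x = X_elem B d" by blast
    have "?r x = (\<Sum>c\<in>orbit B (coAd B s) chi. if c = d then X_elem B d else 0)"
      using d chi by (intro sum.cong) (auto simp: orbit_def char_coord_X_elem)
    then show "x = ?r x" using fin d by simp
  qed
qed

lemma tau_character: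
  fixes \<rho> :: "'a \<Rightarrow> complex^'n^'n"
  assumes chi: "chi \<in> lie_dual B s" and rho: "\<rho> \<in> tau B (orbit B (coAd B s) chi)"
    and b: "b \<in> carrier B"
  shows "rep_character \<rho> b =
    (if b \<in> stabilizer B (coAd B s) chi then of_nat CARD('n) * chi b else 0)"
proof -
  interpret A: vector_space ga_scale by (rule vector_space_ga_scale)
  let ?O = "orbit B (coAd B s) chi"
  \<comment> \<open>The trace of \<open>regular_rep B g\<close> on the orbit space, computed in two
    ways; the factor on the left is the multiplicity of \<open>\<rho>\<close>.\<close>
  have trace: "of_nat CARD('n) * trace (\<rho> g) =
      (if g \<in> stabilizer B (coAd B s) chi then of_nat (card ?O) * chi g else 0)"
    if g: "g \<in> carrier B" for g
    unfolding sum_coords_regular_rep[OF chi g, symmetric]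
  proof (rule multiple_trace[where V = "V_space B ?O" and X = "X_elem B" and l = char_coord
        and \<pi> = "regular_rep B", symmetric])
    show "equivalent_reps B ga_scale (V_space B ?O) (regular_rep B) multiple_scale
        (multiple_space CARD('n)) (multiple_rep \<rho>)"
      using rho by (simp add: tau_def)
    show "finite ?O" using finite_carrier by (simp add: orbit_def)
    show "A.subspace (V_space B ?O)" by (simp add: V_space_def)
    show "X_elem B c \<in> V_space B ?O" if "c \<in> ?O" for c
      using that by (simp add: V_space_def A.span_base)
    show "linear_on ga_scale (V_space B ?O) (*) (char_coord c)" for c
      by (simp add: linear_on_def char_coord_linear)
    show "linear_on ga_scale (V_space B ?O) ga_scale (regular_rep B g)"
      using g by (auto simp: linear_on_def fun_eq_iff regular_rep_apply ga_scale_def)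
  qed (use V_space_representation[OF chi] g in auto)
  have "\<one> \<in> stabilizer B (coAd B s) chi"
    using chi by (simp add: stabilizer_iff commutator_central_right Z_one char_one)
  moreover have "\<rho> \<one> = mat 1"
    using rho by (simp add: tau_def unitary_rep_def)
  \<comment> \<open>At the unit one factor is the multiplicity and the other the trace of the
    identity matrix.\<close>
  ultimately have "of_nat (card ?O) = (of_nat CARD('n) * of_nat CARD('n) :: complex)"
    using trace[of \<one>] chi by (simp add: char_one trace_I)
  then have "of_nat CARD('n) * trace (\<rho> b) = of_nat CARD('n) *
      (if b \<in> stabilizer B (coAd B s) chi then of_nat CARD('n) * chi b else 0)"
    using trace[OF b] by simp
  then show ?thesis
    unfolding rep_character_def by (subst (asm) mult_left_cancel) auto
qed

end

theorem theorem5p8: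
  fixes B :: "('a, 'm) monoid_scheme"
    and s :: "'a set \<Rightarrow> 'a"
    and \<Omega> :: "('a \<Rightarrow> complex) set"
    and \<rho> :: "'a \<Rightarrow> complex^'n^'n"
    and n :: nat
    and chi :: "'a \<Rightarrow> complex"
    and b :: 'a
  assumes "nilpotency_class_2 B"
    and "finite (carrier B)"
    and "odd (order B)"
    and "is_section B s"
    and "\<Omega> \<in> orbits B (lie_dual B s) (coAd B s)"
    and "\<rho> \<in> tau B \<Omega>"
    and "n = CARD('n)"
    and "b \<in> carrier B"
    and "chi \<in> \<Omega>"
  shows "rep_character \<rho> b =
    (if b \<in> stabilizer B (coAd B s) chi then of_nat n * chi b else 0)"
proof -
  interpret group B
    using assms(1) by (simp add: nilpotency_class_2_def)
  interpret odd_class2_group_section B s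
    by unfold_locales (use assms in auto)
  \<comment> \<open>The orbit comes with some base point \<open>chi1\<close>;
    \<open>orbit_eq\<close> moves it to \<open>chi\<close>.\<close>
  obtain chi1 g where chi1: "chi1 \<in> lie_dual B s" and \<Omega>: "\<Omega> = orbit B (coAd B s) chi1"
    and g: "g \<in> carrier B" "chi = coAd B s g chi1"
    using assms(5,9) by (auto simp: orbits_def orbit_def)
  have "chi \<in> lie_dual B s" "\<Omega> = orbit B (coAd B s) chi"
    using coAd_closed orbit_eq chi1 \<Omega> g by auto
  then show ?thesis
    using tau_character[of chi \<rho> b] assms(6-8) by simp
qed

end
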